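(* Let $n\ge 1$ and let $(\xi_i,\mathfrak{F}_i)_{i=0,\dots,n}$ be a sequence of square integrable real-valued martingale differences with $\xi_0=0$ and $\mathfrak F_0$ trivial, and let $S_n=\sum_{i=1}^n\xi_i$. Then for all $b>0$, $M\geq 1$ and $x,y\geq 0$, \[ \mathbb{P}\Big(\frac{S_n}{\sqrt{B_n(y)}}\geq x,\ b\leq \sqrt{B_n(y)}\leq bM\Big) \leq \sqrt{e}\,\big(1+2(1+x)\ln M\big)\exp\Big\{-\frac{x^2}{2(1+\frac{xy}{3b})}\Big\}. \]
   Context: $(\Omega,\mathfrak F,\mathbb P)$ is a probability space with increasing $\sigma$-fields $\{\emptyset,\Omega\}=\mathfrak F_0\subseteq\cdots\subseteq\mathfrak F_n\subseteq\mathfrak F$; each $\xi_i$ is $\mathfrak F_i$-measurable, $\mathbb E[\xi_i\mid\mathfrak F_{i-1}]=0$ and $\mathbb E[\xi_i^2]<\infty$ for $i\ge1$. For $y\ge 0$, \[[S]_n(y)=\sum_{i=1}^{n}\xi_i^2 1_{\{\xi_i>y\}},\qquad \langle S\rangle_n(y)=\sum_{i=1}^{n}\mathbb{E}[\xi_i^21_{\{\xi_i\leq y\}}|\mathfrak{F}_{i-1}],\qquad B_n(y)=[S]_n(y)+\langle S\rangle_n(y).\] *)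

theory Defs
  imports "HOL-Probability.Probability"
begin

(* Everything is indexed by {0..n}; F i and xi i are unconstrained for i > n. *)
definition martingale_differences ::
  "'a measure \<Rightarrow> (nat \<Rightarrow> 'a measure) \<Rightarrow> (nat \<Rightarrow> 'a \<Rightarrow> real) \<Rightarrow> nat \<Rightarrow> bool"
where
  "martingale_differences M F \<xi> n \<longleftrightarrow>
     (\<forall>i\<le>n. subalgebra M (F i)) \<and>
     (\<forall>i j. i \<le> j \<longrightarrow> j \<le> n \<longrightarrow> subalgebra (F j) (F i)) \<and>
     (\<forall>i\<le>n. \<xi> i \<in> borel_measurable (F i)) \<and>
     (\<forall>i\<in>{1..n}. integrable M (\<xi> i)) \<and>
     (\<forall>i\<in>{1..n}. AE \<omega> in M. real_cond_exp M (F (i - 1)) (\<xi> i) \<omega> = 0)"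

definition partial_sum :: "(nat \<Rightarrow> 'a \<Rightarrow> real) \<Rightarrow> nat \<Rightarrow> 'a \<Rightarrow> real" where
  "partial_sum \<xi> n \<omega> = (\<Sum>i=1..n. \<xi> i \<omega>)"

(* [S]_n(y) *)
definition upper_square_bracket :: "(nat \<Rightarrow> 'a \<Rightarrow> real) \<Rightarrow> nat \<Rightarrow> real \<Rightarrow> 'a \<Rightarrow> real" where
  "upper_square_bracket \<xi> n y \<omega> =
     (\<Sum>i=1..n. (\<xi> i \<omega>)\<^sup>2 * indicat_real {\<omega>. \<xi> i \<omega> > y} \<omega>)"

(* <S>_n(y); real_cond_exp selects one version of each conditional expectation,
   so the sum is determined up to a null set. *)
definition lower_angle_bracket ::
  "'a measure \<Rightarrow> (nat \<Rightarrow> 'a measure) \<Rightarrow> (nat \<Rightarrow> 'a \<Rightarrow> real) \<Rightarrow> nat \<Rightarrow> real \<Rightarrow> 'a \<Rightarrow> real"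
where
  "lower_angle_bracket M F \<xi> n y \<omega> =
     (\<Sum>i=1..n. real_cond_exp M (F (i - 1))
        (\<lambda>\<omega>. (\<xi> i \<omega>)\<^sup>2 * indicat_real {\<omega>. \<xi> i \<omega> \<le> y} \<omega>) \<omega>)"

definition B_var ::
  "'a measure \<Rightarrow> (nat \<Rightarrow> 'a measure) \<Rightarrow> (nat \<Rightarrow> 'a \<Rightarrow> real) \<Rightarrow> nat \<Rightarrow> real \<Rightarrow> 'a \<Rightarrow> real"
where
  "B_var M F \<xi> n y \<omega> = upper_square_bracket \<xi> n y \<omega> + lower_angle_bracket M F \<xi> n y \<omega>"

end

theory Submission
  imports Defs
begin

text \<open>
The normaliser \<open>B\<^sub>n(y)\<close> compensates the exponential of \<open>S\<^sub>n\<close>. A large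
increment, \<open>\<xi>\<^sub>i > y\<close>, is compensated pathwise by its own square, because
\<open>exp (u - u\<^sup>2/2) \<le> 1 + u\<close> for \<open>u \<ge> 0\<close>; an increment \<open>\<xi>\<^sub>i \<le> y\<close> is
bounded above, and its conditional second moment suffices, as in Bernstein's inequality. Together
these show that, for \<open>0 \<le> l\<close> with \<open>l y < 3\<close>,
\<open>exp (l S\<^sub>k - l\<^sup>2 B\<^sub>k(y) / (2 (1 - l y / 3)))\<close> is a supermartingale started at 1, so that its
expectation is at most 1 (\<open>exp_truncated_le\<close>, \<open>supermartingale_step\<close>, \<open>exponential_supermartingale\<close>).

If \<open>sqrt B\<^sub>n\<close> were equal to a constant \<open>v\<close>, Markov's inequality with
\<open>l = x / (v w)\<close>, where \<open>w = 1 + x y / (3 v)\<close>, would give the bound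
\<open>exp (- x\<^sup>2 / (2 w))\<close>. With the same \<open>l\<close>, letting \<open>sqrt B\<^sub>n\<close> exceed \<open>v\<close> by
a relative amount of at most \<open>1 / (1 + x)\<close> costs no more than a factor \<open>sqrt e\<close>, since the
exponent is quadratic in \<open>sqrt B\<^sub>n\<close> with its maximum at \<open>v\<close>
(\<open>quadratic_ge_on_band\<close>, \<open>band_probability_le\<close>). The range of \<open>sqrt B\<^sub>n\<close> is covered by
geometric bands of ratio \<open>1 + 1 / (1 + x)\<close>, of which at most \<open>1 + 2 (1 + x) ln K\<close> are
needed (\<open>exists_geometric_band\<close>, \<open>geometric_band_count_le\<close>); the bound on each band is largest for
\<open>v = b\<close>.
\<close>

section \<open>Exponential inequalities\<close>

lemma exp_minus_half_square_le:
  fixes u :: real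
  assumes "u \<ge> 0"
  shows "exp (u - u\<^sup>2 / 2) \<le> 1 + u"
proof -
  define f where "f = (\<lambda>t::real. exp (t\<^sup>2 / 2 - t) * (1 + t))"
  have "f 0 \<le> f u"
  proof (rule DERIV_nonneg_imp_nondecreasing[OF assms])
    fix t :: real
    assume "0 \<le> t" "t \<le> u"
    have "(f has_real_derivative exp (t\<^sup>2 / 2 - t) * t\<^sup>2) (at t)"
      unfolding f_def
      by (auto intro!: derivative_eq_intros simp: algebra_simps power2_eq_square)
    then show "\<exists>d. (f has_real_derivative d) (at t) \<and> 0 \<le> d"
      by (intro exI[of _ "exp (t\<^sup>2 / 2 - t) * t\<^sup>2"]) simp
  qed
  then have "1 \<le> exp (- (u - u\<^sup>2 / 2)) * (1 + u)"
    by (simp add: f_def)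
  then show ?thesis
    by (simp add: exp_minus field_simps)
qed

lemma exp_le_quadratic_of_nonpos:
  fixes u :: real
  assumes "u \<le> 0"
  shows "exp u \<le> 1 + u + u\<^sup>2 / 2"
proof -
  define f where "f = (\<lambda>t::real. 1 + t + t\<^sup>2 / 2 - exp t)"
  have "f 0 \<le> f u"
  proof (rule DERIV_nonpos_imp_nonincreasing[OF assms])
    fix t :: real
    have "(f has_real_derivative 1 + t - exp t) (at t)"
      unfolding f_def by (auto intro!: derivative_eq_intros)
    then show "\<exists>d. (f has_real_derivative d) (at t) \<and> d \<le> 0"
      using exp_ge_add_one_self[of t] by (intro exI[of _ "1 + t - exp t"]) simp
  qed
  then show ?thesis by (simp add: f_def)
qed

text \<open>
Clearing denominators turns the claim into
\<open>exp (- u) * (6 + 4 * u + u\<^sup>2) \<ge> 6 - 2 * u\<close>, an equality at 0; the derivatives of the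
two sides compare by \<open>exp u \<ge> 1 + u + u\<^sup>2 / 2\<close>.
\<close>

lemma exp_le_bernstein_of_nonneg:
  fixes u :: real
  assumes "0 \<le> u" "u < 3"
  shows "exp u \<le> 1 + u + u\<^sup>2 / (2 * (1 - u / 3))"
proof -
  define f where "f = (\<lambda>t::real. exp (- t) * (6 + 4 * t + t\<^sup>2) + 2 * t - 6)"
  have "f 0 \<le> f u"
  proof (rule DERIV_nonneg_imp_nondecreasing[OF \<open>0 \<le> u\<close>])
    fix t :: real
    assume t: "0 \<le> t" "t \<le> u"
    let ?d = "2 - exp (- t) * (2 + 2 * t + t\<^sup>2)"
    have "(f has_real_derivative ?d) (at t)"
      unfolding f_def
      by (auto intro!: derivative_eq_intros simp: algebra_simps power2_eq_square)
    moreover have "0 \<le> ?d"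
      using exp_lower_Taylor_quadratic[OF t(1)] by (simp add: exp_minus field_simps)
    ultimately show "\<exists>d. (f has_real_derivative d) (at t) \<and> 0 \<le> d"
      by blast
  qed
  then have "exp u * (6 - 2 * u) \<le> 6 + 4 * u + u\<^sup>2"
    by (simp add: f_def exp_minus field_simps)
  then have "exp u \<le> (6 + 4 * u + u\<^sup>2) / (6 - 2 * u)"
    using assms by (simp add: pos_le_divide_eq)
  also have "\<dots> = 1 + u + u\<^sup>2 / (2 * (1 - u / 3))"
    using assms by (simp add: field_simps power2_eq_square)
  finally show ?thesis .
qed

definition bernstein_coeff :: "real \<Rightarrow> real" where
  "bernstein_coeff c = 1 / (2 * (1 - c / 3))"

lemma half_le_bernstein_coeff:
  assumes "0 \<le> c" "c < 3"
  shows "1 / 2 \<le> bernstein_coeff c"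
  using assms by (simp add: bernstein_coeff_def field_simps)

text \<open>
The coefficient depends only on the upper bound \<open>c\<close>, so the inequality remains usable when
\<open>u\<close> is an increment that is unbounded below.
\<close>

lemma exp_le_bernstein:
  fixes u c :: real
  assumes "u \<le> c" "0 \<le> c" "c < 3"
  shows "exp u \<le> 1 + u + bernstein_coeff c * u\<^sup>2"
proof (cases "u \<le> 0")
  case True
  have "u\<^sup>2 / 2 \<le> bernstein_coeff c * u\<^sup>2"
    using mult_right_mono[OF half_le_bernstein_coeff[OF assms(2,3)], of "u\<^sup>2"] by simp
  then show ?thesis
    using exp_le_quadratic_of_nonpos[OF True] by linarith
next
  case False
  have "u\<^sup>2 / (2 * (1 - u / 3)) \<le> u\<^sup>2 / (2 * (1 - c / 3))"
    using assms by (intro divide_left_mono) (auto intro!: mult_pos_pos)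
  then show ?thesis
    using exp_le_bernstein_of_nonneg[of u] False assms by (simp add: bernstein_coeff_def)
qed

text \<open>
The right-hand side is affine in \<open>z\<close> and in the truncated square \<open>z\<^sup>2 * of_bool (z \<le> y)\<close>, so
its conditional expectation is explicit. For \<open>z > y\<close> the subtracted square makes
\<open>exp_minus_half_square_le\<close> applicable because the coefficient is at least \<open>1/2\<close>. The second
bound is a constant; it makes the exponential integrable for increments with only two moments.
\<close>

lemma exp_truncated_le:
  fixes l y z :: real
  assumes l: "0 \<le> l" and y: "0 \<le> y" and ly: "l * y < 3"
  defines "\<kappa> \<equiv> bernstein_coeff (l * y)"
  shows "exp (l * z - l\<^sup>2 * \<kappa> * (z\<^sup>2 * of_bool (z > y)))
           \<le> 1 + l * z + l\<^sup>2 * \<kappa> * (z\<^sup>2 * of_bool (z \<le> y))"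
    and "exp (l * z - l\<^sup>2 * \<kappa> * (z\<^sup>2 * of_bool (z > y))) \<le> exp (l * y + 1 / 2)"
proof -
  have \<kappa>: "1 / 2 \<le> \<kappa>"
    unfolding \<kappa>_def using l y ly by (intro half_le_bernstein_coeff) auto
  have sub: "l * z - l\<^sup>2 * \<kappa> * z\<^sup>2 \<le> l * z - (l * z)\<^sup>2 / 2"
    using mult_right_mono[OF \<kappa>, of "(l * z)\<^sup>2"] by (simp add: power_mult_distrib mult_ac)
  show "exp (l * z - l\<^sup>2 * \<kappa> * (z\<^sup>2 * of_bool (z > y)))
           \<le> 1 + l * z + l\<^sup>2 * \<kappa> * (z\<^sup>2 * of_bool (z \<le> y))"
  proof (cases "z > y")
    case True
    then have "exp (l * z - (l * z)\<^sup>2 / 2) \<le> 1 + l * z"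
      using l y by (intro exp_minus_half_square_le) simp
    moreover have "exp (l * z - l\<^sup>2 * \<kappa> * z\<^sup>2) \<le> exp (l * z - (l * z)\<^sup>2 / 2)"
      using sub by simp
    ultimately have "exp (l * z - l\<^sup>2 * \<kappa> * z\<^sup>2) \<le> 1 + l * z"
      by (rule order_trans[rotated])
    then show ?thesis using True by simp
  next
    case False
    then have "exp (l * z) \<le> 1 + l * z + \<kappa> * (l * z)\<^sup>2"
      unfolding \<kappa>_def using l y ly by (intro exp_le_bernstein) (auto intro: mult_left_mono)
    then show ?thesis using False by (simp add: power_mult_distrib mult_ac)
  qed
  show "exp (l * z - l\<^sup>2 * \<kappa> * (z\<^sup>2 * of_bool (z > y))) \<le> exp (l * y + 1 / 2)"
  proof (cases "z > y")
    case True
    have "l * z - (l * z)\<^sup>2 / 2 \<le> 1 / 2"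
      using zero_le_power2[of "l * z - 1"] by (simp add: power2_eq_square algebra_simps)
    moreover have "0 \<le> l * y" using l y by simp
    ultimately show ?thesis using True sub by simp
  next
    case False
    then have "l * z \<le> l * y" using l by (intro mult_left_mono) auto
    then show ?thesis using False by simp
  qed
qed

section \<open>The exponential supermartingale\<close>

text \<open>
Conditionally on \<open>G\<close>, \<open>exp_truncated_le\<close> and the centring of \<open>X\<close> bound the mean of the
factor containing \<open>X\<close> by \<open>1 + l\<^sup>2 \<kappa> V \<le> exp (l\<^sup>2 \<kappa> V)\<close>, which the factor
\<open>exp (- l\<^sup>2 \<kappa> V)\<close> cancels. The almost sure upper bound has the same form as the assumption on
\<open>W\<close>, so that the step can be iterated.
\<close>

lemma supermartingale_step:
  fixes W X :: "'a \<Rightarrow> real" and l y C :: real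
  assumes prob: "prob_space M" and sub: "subalgebra M G"
    and W: "W \<in> borel_measurable G" "\<And>\<omega>. 0 \<le> W \<omega>" "AE \<omega> in M. W \<omega> \<le> C"
    and X: "X \<in> borel_measurable M" "integrable M X" "integrable M (\<lambda>\<omega>. (X \<omega>)\<^sup>2)"
    and centred: "AE \<omega> in M. real_cond_exp M G X \<omega> = 0"
    and l: "0 \<le> l" and y: "0 \<le> y" and ly: "l * y < 3"
  defines "\<kappa> \<equiv> bernstein_coeff (l * y)"
    and "V \<equiv> real_cond_exp M G (\<lambda>\<omega>. (X \<omega>)\<^sup>2 * of_bool (X \<omega> \<le> y))"
  defines "Y \<equiv> \<lambda>\<omega>. W \<omega> * exp (l * X \<omega> - l\<^sup>2 * \<kappa> * ((X \<omega>)\<^sup>2 * of_bool (X \<omega> > y) + V \<omega>))"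
  shows "AE \<omega> in M. Y \<omega> \<le> C * exp (l * y + 1 / 2)"
    and "(\<integral>\<omega>. Y \<omega> \<partial>M) \<le> (\<integral>\<omega>. W \<omega> \<partial>M)"
proof -
  interpret prob_space M by (fact prob)
  interpret finite_measure_subalgebra M G by unfold_locales (fact sub)
  note [measurable] = X(1)
  define Q where "Q = (\<lambda>\<omega>. (X \<omega>)\<^sup>2 * of_bool (X \<omega> \<le> y) :: real)"
  \<comment> \<open>\<open>P\<close> collects the \<open>G\<close>-measurable factors of \<open>Y\<close>; they are bounded because
    \<open>V \<ge> 0\<close> almost surely, so \<open>P\<close> may be moved across the conditional expectation.\<close>
  define P where "P = (\<lambda>\<omega>. W \<omega> * exp (- (l\<^sup>2 * \<kappa> * V \<omega>)))"
  define Z where "Z = (\<lambda>\<omega>. exp (l * X \<omega> - l\<^sup>2 * \<kappa> * ((X \<omega>)\<^sup>2 * of_bool (X \<omega> > y))))"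
  have \<kappa>: "1 / 2 \<le> \<kappa>"
    unfolding \<kappa>_def using l y ly by (intro half_le_bernstein_coeff) auto
  have Q[measurable]: "Q \<in> borel_measurable M" unfolding Q_def by measurable
  have intQ: "integrable M Q"
    by (rule Bochner_Integration.integrable_bound[OF X(3)]) (auto simp: Q_def)
  have VQ: "V = real_cond_exp M G Q" by (simp add: V_def Q_def)
  have V[measurable]: "V \<in> borel_measurable G" "V \<in> borel_measurable M"
    unfolding VQ by (rule borel_measurable_cond_exp, rule borel_measurable_cond_exp2)
  have V0: "AE \<omega> in M. 0 \<le> V \<omega>"
    unfolding VQ by (rule real_cond_exp_pos) (auto simp: Q_def)
  note W(1)[measurable]
  have WM[measurable]: "W \<in> borel_measurable M"
    using W(1) sub measurable_from_subalg by blast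
  have PG[measurable]: "P \<in> borel_measurable G" unfolding P_def by measurable
  have P[measurable]: "P \<in> borel_measurable M"  unfolding P_def by measurable
  have P0: "0 \<le> P \<omega>" for \<omega> using W(2) by (simp add: P_def)
  have PC: "AE \<omega> in M. P \<omega> \<le> C"
    using W(3) V0
  proof eventually_elim
    case (elim \<omega>)
    have "P \<omega> \<le> W \<omega> * 1"
      unfolding P_def using elim \<kappa> W(2) by (intro mult_left_mono) auto
    then show ?case using elim by simp
  qed
  have YPZ: "Y \<omega> = P \<omega> * Z \<omega>" for \<omega>
    by (simp add: Y_def P_def Z_def mult_exp_exp algebra_simps)
  have C: "0 \<le> C"
  proof -
    have "AE \<omega> in M. 0 \<le> C"
      using W(3) by eventually_elim (use W(2) order_trans in blast)
    then show ?thesis by simp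
  qed
  show bdd: "AE \<omega> in M. Y \<omega> \<le> C * exp (l * y + 1 / 2)"
    using PC
  proof eventually_elim
    case (elim \<omega>)
    then show ?case
      unfolding YPZ Z_def \<kappa>_def using C exp_truncated_le(2)[OF l y ly, of "X \<omega>"]
      by (intro mult_mono) auto
  qed
  have int_mult: "integrable M (\<lambda>\<omega>. P \<omega> * R \<omega>)" if "integrable M R" for R
  proof (rule Bochner_Integration.integrable_bound)
    show "integrable M (\<lambda>\<omega>. C * R \<omega>)" using that by simp
    show "(\<lambda>\<omega>. P \<omega> * R \<omega>) \<in> borel_measurable M" using that by measurable
    show "AE \<omega> in M. norm (P \<omega> * R \<omega>) \<le> norm (C * R \<omega>)"
      using PC by eventually_elim (use P0 C in \<open>auto simp: abs_mult intro!: mult_right_mono\<close>)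
  qed
  have intP: "integrable M P" using int_mult[of "\<lambda>_. 1"] by simp
  have intW: "integrable M W"
    by (rule integrable_const_bound[of _ C]) (use W(2,3) in auto)
  have PX: "(\<integral>\<omega>. P \<omega> * X \<omega> \<partial>M) = 0"
  proof -
    have "(\<integral>\<omega>. P \<omega> * X \<omega> \<partial>M) = (\<integral>\<omega>. P \<omega> * real_cond_exp M G X \<omega> \<partial>M)"
      by (rule real_cond_exp_intg(2)[symmetric]) (auto intro: int_mult X)
    also have "\<dots> = (\<integral>\<omega>. 0 \<partial>M)"
      by (rule integral_cong_AE) (use centred in auto)
    finally show ?thesis by simp
  qed
  have PQ: "(\<integral>\<omega>. P \<omega> * Q \<omega> \<partial>M) = (\<integral>\<omega>. P \<omega> * V \<omega> \<partial>M)"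
    unfolding VQ by (rule real_cond_exp_intg(2)[symmetric]) (auto intro: int_mult intQ)
  have intPV: "integrable M (\<lambda>\<omega>. P \<omega> * V \<omega>)"
    unfolding VQ by (rule real_cond_exp_intg(1)) (auto intro: int_mult intQ)
  note ints = intP int_mult[OF X(2)] int_mult[OF intQ] intPV
  have "(\<integral>\<omega>. Y \<omega> \<partial>M) \<le> (\<integral>\<omega>. P \<omega> + l * (P \<omega> * X \<omega>) + l\<^sup>2 * \<kappa> * (P \<omega> * Q \<omega>) \<partial>M)"
  proof (rule integral_mono_AE)
    show "integrable M (\<lambda>\<omega>. P \<omega> + l * (P \<omega> * X \<omega>) + l\<^sup>2 * \<kappa> * (P \<omega> * Q \<omega>))"
      using ints by simp
    have "Y \<in> borel_measurable M" unfolding Y_def by measurable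
    then show "integrable M Y"
      using bdd W(2) by (intro integrable_const_bound[of _ "C * exp (l * y + 1 / 2)"]) (auto simp: Y_def)
    show "AE \<omega> in M. Y \<omega> \<le> P \<omega> + l * (P \<omega> * X \<omega>) + l\<^sup>2 * \<kappa> * (P \<omega> * Q \<omega>)"
    proof (rule AE_I2)
      fix \<omega>
      have "Y \<omega> \<le> P \<omega> * (1 + l * X \<omega> + l\<^sup>2 * \<kappa> * Q \<omega>)"
        unfolding YPZ Z_def Q_def \<kappa>_def
        by (intro mult_left_mono exp_truncated_le(1)[OF l y ly] P0)
      then show "Y \<omega> \<le> P \<omega> + l * (P \<omega> * X \<omega>) + l\<^sup>2 * \<kappa> * (P \<omega> * Q \<omega>)"
        by (simp add: algebra_simps)
    qed
  qed
  also have "\<dots> = (\<integral>\<omega>. P \<omega> + l\<^sup>2 * \<kappa> * (P \<omega> * V \<omega>) \<partial>M)"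
    using ints by (simp add: PX PQ)
  also have "\<dots> \<le> (\<integral>\<omega>. W \<omega> \<partial>M)"
  proof (rule integral_mono)
    show "integrable M (\<lambda>\<omega>. P \<omega> + l\<^sup>2 * \<kappa> * (P \<omega> * V \<omega>))" using ints by simp
    show "integrable M W" by (fact intW)
    fix \<omega>
    let ?t = "l\<^sup>2 * \<kappa> * V \<omega>"
    have "exp (- ?t) * (1 + ?t) \<le> exp (- ?t) * exp ?t"
      by (intro mult_left_mono exp_ge_add_one_self) simp
    then have "exp (- ?t) * (1 + ?t) \<le> 1" by (simp add: exp_minus_inverse mult.commute)
    then have "W \<omega> * (exp (- ?t) * (1 + ?t)) \<le> W \<omega> * 1"
      by (rule mult_left_mono) (fact W(2))
    then show "P \<omega> + l\<^sup>2 * \<kappa> * (P \<omega> * V \<omega>) \<le> W \<omega>"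
      by (simp add: P_def algebra_simps)
  qed
  finally show "(\<integral>\<omega>. Y \<omega> \<partial>M) \<le> (\<integral>\<omega>. W \<omega> \<partial>M)" .
qed

lemma martingale_differences_measurable:
  assumes "martingale_differences M F \<xi> n" "k \<le> n"
  shows "partial_sum \<xi> k \<in> borel_measurable (F k)"
    and "B_var M F \<xi> k y \<in> borel_measurable (F k)"
proof -
  have mono: "f \<in> borel_measurable (F k)" if "f \<in> borel_measurable (F i)" "i \<le> k"
    for f :: "'a \<Rightarrow> real" and i
    using that assms measurable_from_subalg[of "F k" "F i"]
    unfolding martingale_differences_def by blast
  have \<xi>[measurable]: "\<xi> i \<in> borel_measurable (F k)" if "i \<in> {1..k}" for i
    using that assms by (intro mono[of _ i]) (auto simp: martingale_differences_def)
  have V[measurable]: "real_cond_exp M (F (i - 1)) f \<in> borel_measurable (F k)" if "i \<in> {1..k}" for i f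
    using that by (intro mono[of _ "i - 1"]) auto
  show "partial_sum \<xi> k \<in> borel_measurable (F k)"
    unfolding partial_sum_def[abs_def] by measurable
  show "B_var M F \<xi> k y \<in> borel_measurable (F k)"
    unfolding B_var_def[abs_def] upper_square_bracket_def lower_angle_bracket_def indicator_def
      mem_Collect_eq
    by measurable
qed

lemma partial_sum_Suc: "partial_sum \<xi> (Suc k) \<omega> = partial_sum \<xi> k \<omega> + \<xi> (Suc k) \<omega>"
  by (simp add: partial_sum_def)

lemma B_var_Suc:
  "B_var M F \<xi> (Suc k) y \<omega> = B_var M F \<xi> k y \<omega> +
     ((\<xi> (Suc k) \<omega>)\<^sup>2 * of_bool (\<xi> (Suc k) \<omega> > y) +
      real_cond_exp M (F k) (\<lambda>\<omega>. (\<xi> (Suc k) \<omega>)\<^sup>2 * of_bool (\<xi> (Suc k) \<omega> \<le> y)) \<omega>)"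
proof -
  have ind: "of_bool (Q \<omega>) = indicat_real {\<omega>. Q \<omega>} \<omega>" for Q and \<omega> :: 'a
    by (simp add: indicator_def)
  show ?thesis
    unfolding ind[of "\<lambda>\<omega>. \<xi> (Suc k) \<omega> > y"] ind[of "\<lambda>\<omega>. \<xi> (Suc k) \<omega> \<le> y"]
      B_var_def upper_square_bracket_def lower_angle_bracket_def
    by (simp del: indicator_simps)
qed

text \<open>
Induction along \<open>supermartingale_step\<close> from \<open>U 0 = 1\<close>. The upper bound on \<open>U k\<close> that is
carried along may depend on \<open>k\<close>; it serves only to provide integrability.
\<close>

lemma exponential_supermartingale:
  fixes \<xi> :: "nat \<Rightarrow> 'a \<Rightarrow> real" and l y :: real
  assumes prob: "prob_space M"
    and md: "martingale_differences M F \<xi> n"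
    and sq: "\<And>i. i \<in> {1..n} \<Longrightarrow> integrable M (\<lambda>\<omega>. (\<xi> i \<omega>)\<^sup>2)"
    and l: "0 \<le> l" and y: "0 \<le> y" and ly: "l * y < 3"
  defines "U \<equiv> \<lambda>k \<omega>. exp (l * partial_sum \<xi> k \<omega> - l\<^sup>2 * bernstein_coeff (l * y) * B_var M F \<xi> k y \<omega>)"
  assumes k: "k \<le> n"
  shows "integrable M (U k)" and "(\<integral>\<omega>. U k \<omega> \<partial>M) \<le> 1"
proof -
  interpret prob_space M by (fact prob)
  have sub: "subalgebra M (F i)" if "i \<le> n" for i
    using md that by (auto simp: martingale_differences_def)
  have meas: "U i \<in> borel_measurable (F i)" if "i \<le> n" for i
  proof -
    note [measurable] = martingale_differences_measurable[OF md that]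
    show ?thesis unfolding U_def by measurable
  qed
  have "(\<exists>C. AE \<omega> in M. U k \<omega> \<le> C) \<and> (\<integral>\<omega>. U k \<omega> \<partial>M) \<le> 1"
    using k
  proof (induction k)
    case 0
    have empty: "{1..0::nat} = {}" by simp
    have "U 0 = (\<lambda>_. 1)"
      unfolding U_def partial_sum_def B_var_def upper_square_bracket_def
        lower_angle_bracket_def empty sum.empty by simp
    then show ?case by (auto simp: prob_space)
  next
    case (Suc k)
    then obtain C where C: "AE \<omega> in M. U k \<omega> \<le> C" and le1: "(\<integral>\<omega>. U k \<omega> \<partial>M) \<le> 1"
      by auto
    have k: "k \<le> n" "Suc k \<le> n" "Suc k \<in> {1..n}" using Suc.prems by auto
    have "\<xi> (Suc k) \<in> borel_measurable (F (Suc k))" and X2: "integrable M (\<xi> (Suc k))"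
      using md k unfolding martingale_differences_def by blast+
    then have X1: "\<xi> (Suc k) \<in> borel_measurable M"
      using measurable_from_subalg[OF sub[OF k(2)]] by blast
    have "AE \<omega> in M. real_cond_exp M (F (Suc k - 1)) (\<xi> (Suc k)) \<omega> = 0"
      using md k(3) unfolding martingale_differences_def by blast
    then have X3: "AE \<omega> in M. real_cond_exp M (F k) (\<xi> (Suc k)) \<omega> = 0" by simp
    have U0: "0 \<le> U k \<omega>" for \<omega> by (simp add: U_def)
    note step = supermartingale_step[OF prob sub[OF k(1)] meas[OF k(1)] U0 C X1 X2
        sq[OF k(3)] X3 l y ly]
    have "U (Suc k) = (\<lambda>\<omega>. U k \<omega> *
        exp (l * \<xi> (Suc k) \<omega> - l\<^sup>2 * bernstein_coeff (l * y) *
          ((\<xi> (Suc k) \<omega>)\<^sup>2 * of_bool (\<xi> (Suc k) \<omega> > y) +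
           real_cond_exp M (F k) (\<lambda>\<omega>. (\<xi> (Suc k) \<omega>)\<^sup>2 * of_bool (\<xi> (Suc k) \<omega> \<le> y)) \<omega>)))"
      by (rule ext) (simp add: U_def partial_sum_Suc B_var_Suc mult_exp_exp algebra_simps)
    then have "AE \<omega> in M. U (Suc k) \<omega> \<le> C * exp (l * y + 1 / 2)"
      and "(\<integral>\<omega>. U (Suc k) \<omega> \<partial>M) \<le> (\<integral>\<omega>. U k \<omega> \<partial>M)"
      by (simp_all only: step)
    then show ?case
      using le1 by (blast intro: order_trans)
  qed
  then obtain C where C: "AE \<omega> in M. U k \<omega> \<le> C" and le1: "(\<integral>\<omega>. U k \<omega> \<partial>M) \<le> 1"
    by auto
  have "U k \<in> borel_measurable M"
    using measurable_from_subalg[OF sub[OF k] meas[OF k]] .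
  then show "integrable M (U k)"
    using C by (intro integrable_const_bound[of _ C]) (auto simp: U_def)
  show "(\<integral>\<omega>. U k \<omega> \<partial>M) \<le> 1" by (fact le1)
qed

section \<open>Geometric bands for the normaliser\<close>

text \<open>
As a function of \<open>r\<close>, the exponent at \<open>s = x * r\<close> equals
\<open>(x\<^sup>2 - (x * \<rho>)\<^sup>2) / (2 * w)\<close> with \<open>\<rho> = r / v - 1\<close>. The width of the band is chosen so
that \<open>x * \<rho> \<le> 1\<close>.
\<close>

lemma quadratic_ge_on_band:
  fixes r s v x w :: real
  assumes v: "0 < v" and w: "0 < w" and x: "0 \<le> x"
    and r: "v \<le> r" "r \<le> v * (1 + 1 / (1 + x))" and s: "x * r \<le> s"
  shows "x\<^sup>2 / (2 * w) - 1 / 2 / w \<le> x / (v * w) * s - (x / (v * w))\<^sup>2 * (w / 2) * r\<^sup>2"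
proof -
  define \<rho> where "\<rho> = r / v - 1"
  have r_eq: "r = v * (1 + \<rho>)" using v by (simp add: \<rho>_def)
  have \<rho>: "0 \<le> \<rho>" "\<rho> \<le> 1 / (1 + x)"
    using r v unfolding r_eq by auto
  have "x * \<rho> \<le> x * (1 / (1 + x))" using \<rho> x by (intro mult_left_mono) auto
  also have "\<dots> \<le> 1" using x by simp
  finally have "(x * \<rho>)\<^sup>2 \<le> 1" using \<rho> x by (simp add: power_le_one)
  then have "(x\<^sup>2 - 1) / (2 * w) \<le> (x\<^sup>2 - (x * \<rho>)\<^sup>2) / (2 * w)"
    using w by (intro divide_right_mono) auto
  also have "\<dots> = x / (v * w) * (x * r) - (x / (v * w))\<^sup>2 * (w / 2) * r\<^sup>2"
    unfolding r_eq using v w by (simp add: field_simps power2_eq_square)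
  also have "\<dots> \<le> x / (v * w) * s - (x / (v * w))\<^sup>2 * (w / 2) * r\<^sup>2"
    using s x v w by (intro diff_right_mono mult_left_mono) auto
  finally show ?thesis by (simp add: diff_divide_distrib)
qed

text \<open>
Markov's inequality for the exponential supermartingale, with the parameter \<open>l\<close> that would be
used if \<open>sqrt B\<^sub>n\<close> were equal to \<open>v\<close>.
\<close>

lemma band_probability_le:
  fixes \<xi> :: "nat \<Rightarrow> 'a \<Rightarrow> real" and v x y :: real
  assumes prob: "prob_space M"
    and md: "martingale_differences M F \<xi> n"
    and sq: "\<And>i. i \<in> {1..n} \<Longrightarrow> integrable M (\<lambda>\<omega>. (\<xi> i \<omega>)\<^sup>2)"
    and v: "0 < v" and x: "0 \<le> x" and y: "0 \<le> y"
  shows "measure M {\<omega> \<in> space M. partial_sum \<xi> n \<omega> / sqrt (B_var M F \<xi> n y \<omega>) \<ge> x \<and>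
            v \<le> sqrt (B_var M F \<xi> n y \<omega>) \<and>
            sqrt (B_var M F \<xi> n y \<omega>) \<le> v * (1 + 1 / (1 + x))}
         \<le> sqrt (exp 1) * exp (- (x\<^sup>2 / (2 * (1 + x * y / (3 * v)))))"
    (is "measure M ?A \<le> _")
proof -
  interpret prob_space M by (fact prob)
  define w where "w = 1 + x * y / (3 * v)"
  define l where "l = x / (v * w)"
  define U where "U = (\<lambda>\<omega>. exp (l * partial_sum \<xi> n \<omega> -
      l\<^sup>2 * bernstein_coeff (l * y) * B_var M F \<xi> n y \<omega>))"
  define t where "t = x\<^sup>2 / (2 * w) - 1 / 2"
  have w: "1 \<le> w" using v x y by (simp add: w_def)
  have l: "0 \<le> l" using x v w by (simp add: l_def)
  \<comment> \<open>\<open>l\<close> solves \<open>l = x / v * (1 - l * y / 3)\<close>, so the coefficient of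
    \<open>l\<^sup>2 * B\<close> becomes \<open>w / 2\<close>.\<close>
  have ly: "l * y / 3 = 1 - 1 / w"
  proof -
    have "x * y / 3 = v * w - v" using v by (simp add: w_def algebra_simps)
    moreover have "l * y / 3 = (x * y / 3) / (v * w)" by (simp add: l_def)
    ultimately show ?thesis using v w by (simp add: diff_divide_distrib)
  qed
  have "0 < 1 / w" using w by simp
  with ly have ly3: "l * y < 3" by linarith
  have coeff: "bernstein_coeff (l * y) = w / 2"
    unfolding bernstein_coeff_def ly by simp
  note int = exponential_supermartingale[OF prob md sq l y ly3 order_refl, folded U_def]
  have "measure M ?A \<le> measure M {\<omega> \<in> space M. exp t \<le> U \<omega>}"
  proof (rule finite_measure_mono)
    have [measurable]: "U \<in> borel_measurable M" using int by auto
    show "{\<omega> \<in> space M. exp t \<le> U \<omega>} \<in> sets M" by measurable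
    show "?A \<subseteq> {\<omega> \<in> space M. exp t \<le> U \<omega>}"
    proof safe
      fix \<omega>
      let ?S = "partial_sum \<xi> n \<omega>" and ?B = "B_var M F \<xi> n y \<omega>"
      assume *: "x \<le> ?S / sqrt ?B" "v \<le> sqrt ?B" "sqrt ?B \<le> v * (1 + 1 / (1 + x))"
      have r: "0 < sqrt ?B" using * v by linarith
      then have S: "x * sqrt ?B \<le> ?S" using *(1) by (simp add: pos_le_divide_eq)
      have "t \<le> x\<^sup>2 / (2 * w) - 1 / 2 / w"
        using w by (simp add: t_def)
      also have "\<dots> \<le> l * ?S - l\<^sup>2 * (w / 2) * (sqrt ?B)\<^sup>2"
        unfolding l_def using w by (intro quadratic_ge_on_band v x * S) auto
      finally show "exp t \<le> U \<omega>"
        using r by (simp add: U_def coeff)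
    qed
  qed
  also have "\<dots> \<le> (\<integral>\<omega>. U \<omega> \<partial>M) / exp t"
    using int sets.top by (intro integral_Markov_inequality_measure) (auto simp: U_def)
  also have "\<dots> \<le> 1 / exp t"
    using int by (intro divide_right_mono) auto
  also have "\<dots> = exp (1 / 2 + - (x\<^sup>2 / (2 * w)))"
    using exp_minus[of t] by (simp add: t_def inverse_eq_divide)
  also have "\<dots> = exp (1 / 2) * exp (- (x\<^sup>2 / (2 * w)))"
    by (rule exp_add)
  also have "exp (1 / 2) = sqrt (exp 1 :: real)"
    by (rule real_sqrt_unique[symmetric]) (auto simp: exp_double[symmetric])
  finally show ?thesis by (simp add: w_def)
qed

lemma exists_geometric_band:
  fixes a b r K :: real
  assumes a: "1 < a" and b: "0 < b" and r: "b \<le> r" "r \<le> b * K"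
  shows "\<exists>k \<le> nat \<lfloor>log a K\<rfloor>. b * a ^ k \<le> r \<and> r \<le> b * a ^ k * a"
proof -
  define s where "s = log a (r / b)"
  define k where "k = nat \<lfloor>s\<rfloor>"
  have rb: "1 \<le> r / b" "r / b \<le> K"
    using b r by (auto simp: field_simps)
  have s: "0 \<le> s" "s \<le> log a K"
    unfolding s_def using a rb by auto
  have "real k \<le> s" "s < real k + 1" using s unfolding k_def by linarith+
  then have "a powr real k \<le> a powr s" "a powr s \<le> a powr (real k + 1)" using a by auto
  moreover have "a powr s = r / b" using a rb by (simp add: s_def)
  ultimately have "a ^ k \<le> r / b" "r / b \<le> a ^ k * a"
    using a by (auto simp: powr_realpow powr_add)
  then have "b * a ^ k \<le> r \<and> r \<le> b * a ^ k * a"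
    using b by (simp add: field_simps)
  moreover have "k \<le> nat \<lfloor>log a K\<rfloor>"
    unfolding k_def using s by (intro nat_mono floor_mono)
  ultimately show ?thesis by blast
qed

text \<open>
The factor 2 comes from \<open>ln a \<ge> 1 - 1 / a = 1 / (2 + x) \<ge> 1 / (2 * (1 + x))\<close> for the ratio
\<open>a = 1 + 1 / (1 + x)\<close>.
\<close>

lemma geometric_band_count_le:
  fixes x K :: real
  assumes x: "0 \<le> x" and K: "1 \<le> K"
  shows "real (nat \<lfloor>log (1 + 1 / (1 + x)) K\<rfloor>) \<le> 2 * (1 + x) * ln K"
proof -
  define a where "a = 1 + 1 / (1 + x)"
  have a: "1 < a" using x by (simp add: a_def)
  have "1 / (2 * (1 + x)) \<le> 1 - 1 / a"
    using x by (simp add: a_def field_simps)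
  also have "\<dots> \<le> ln a"
    using ln_le_minus_one[of "1 / a"] a by (simp add: ln_div)
  finally have ln_a: "1 / (2 * (1 + x)) \<le> ln a" .
  have "0 \<le> log a K" using a K by simp
  then have "real (nat \<lfloor>log a K\<rfloor>) \<le> log a K" by simp
  also have "\<dots> = ln K / ln a" by (simp add: log_def)
  also have "\<dots> \<le> ln K / (1 / (2 * (1 + x)))"
    using ln_a x K a by (intro divide_left_mono) auto
  finally show ?thesis by (simp add: a_def mult.commute)
qed

section \<open>The self-normalised deviation inequality\<close>

text \<open>
The bands are indexed from 0 to \<open>m\<close>, inclusive, so that one band remains when \<open>K = 1\<close>; this
is the summand 1 in \<open>1 + 2 * (1 + x) * ln K\<close>.
\<close>

theorem theorem2p2:
  fixes M :: "'a measure" and F :: "nat \<Rightarrow> 'a measure"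
    and \<xi> :: "nat \<Rightarrow> 'a \<Rightarrow> real" and n :: nat and b K x y :: real
  assumes "prob_space M"
    and "n \<ge> 1"
    and "martingale_differences M F \<xi> n"
    and "\<And>i. i \<in> {1..n} \<Longrightarrow> integrable M (\<lambda>\<omega>. (\<xi> i \<omega>)\<^sup>2)"
    and "\<And>\<omega>. \<omega> \<in> space M \<Longrightarrow> \<xi> 0 \<omega> = 0"
    and "sets (F 0) = {{}, space M}"
    and "b > 0" and "K \<ge> 1" and "x \<ge> 0" and "y \<ge> 0"
  shows "measure M {\<omega> \<in> space M.
            partial_sum \<xi> n \<omega> / sqrt (B_var M F \<xi> n y \<omega>) \<ge> x \<and>
            b \<le> sqrt (B_var M F \<xi> n y \<omega>) \<and> sqrt (B_var M F \<xi> n y \<omega>) \<le> b * K}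
         \<le> sqrt (exp 1) * (1 + 2 * (1 + x) * ln K) *
             exp (- (x\<^sup>2 / (2 * (1 + x * y / (3 * b)))))"
    (is "measure M ?E \<le> _")
proof -
  interpret prob_space M by fact
  note md = assms(3) and b = \<open>b > 0\<close> and x = \<open>x \<ge> 0\<close> and y = \<open>y \<ge> 0\<close>
  define a where "a = 1 + 1 / (1 + x)"
  define m where "m = nat \<lfloor>log a K\<rfloor>"
  define S where "S = partial_sum \<xi> n"
  define R where "R = (\<lambda>\<omega>. sqrt (B_var M F \<xi> n y \<omega>))"
  define A where "A = (\<lambda>k. {\<omega> \<in> space M. x \<le> S \<omega> / R \<omega> \<and>
      b * a ^ k \<le> R \<omega> \<and> R \<omega> \<le> b * a ^ k * a})"
  let ?p = "sqrt (exp 1) * exp (- (x\<^sup>2 / (2 * (1 + x * y / (3 * b)))))"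
  have a: "1 < a" using x by (simp add: a_def)
  have sub: "subalgebra M (F n)" using md by (simp add: martingale_differences_def)
  note meas = martingale_differences_measurable[OF md order_refl]
  note [measurable] = measurable_from_subalg[OF sub meas(1)] measurable_from_subalg[OF sub meas(2)]
  have [measurable]: "S \<in> borel_measurable M" "R \<in> borel_measurable M"
    unfolding S_def R_def by measurable
  have A: "A k \<in> sets M" for k unfolding A_def by measurable
  have "measure M ?E \<le> measure M (\<Union>k\<le>m. A k)"
  proof (rule finite_measure_mono)
    show "?E \<subseteq> (\<Union>k\<le>m. A k)"
    proof
      fix \<omega>
      assume E: "\<omega> \<in> ?E"
      then have "b \<le> R \<omega>" "R \<omega> \<le> b * K" by (simp_all add: R_def)
      from exists_geometric_band[OF a b this] obtain k
        where "k \<le> m" "b * a ^ k \<le> R \<omega>" "R \<omega> \<le> b * a ^ k * a"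
        unfolding m_def by blast
      then have "k \<le> m" "\<omega> \<in> A k" using E by (simp_all add: A_def S_def R_def)
      then show "\<omega> \<in> (\<Union>k\<le>m. A k)" by blast
    qed
  qed (use A in auto)
  also have "\<dots> \<le> (\<Sum>k\<le>m. measure M (A k))"
    using A by (intro finite_measure_subadditive_finite) auto
  also have "\<dots> \<le> (\<Sum>k\<le>m. ?p)"
  proof (rule sum_mono)
    fix k
    have "1 \<le> a ^ k" using a by simp
    then have bv: "b \<le> b * a ^ k" using b by simp
    then have v: "0 < b * a ^ k" using b by linarith
    have "measure M (A k) \<le> sqrt (exp 1) * exp (- (x\<^sup>2 / (2 * (1 + x * y / (3 * (b * a ^ k))))))"
      unfolding A_def S_def R_def a_def
      by (rule band_probability_le[OF assms(1) md assms(4) v[unfolded a_def] x y])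
    also have "\<dots> \<le> ?p"
    proof -
      have "x * y / (3 * (b * a ^ k)) \<le> x * y / (3 * b)"
        using bv b x y by (intro divide_left_mono) auto
      moreover have "0 \<le> x * y / (3 * (b * a ^ k))" using bv b x y by auto
      ultimately have "x\<^sup>2 / (2 * (1 + x * y / (3 * b))) \<le> x\<^sup>2 / (2 * (1 + x * y / (3 * (b * a ^ k))))"
        by (intro divide_left_mono) (auto intro!: mult_pos_pos)
      then show ?thesis by simp
    qed
    finally show "measure M (A k) \<le> ?p" .
  qed
  also have "\<dots> = (1 + real m) * ?p" by simp
  also have "\<dots> \<le> (1 + 2 * (1 + x) * ln K) * ?p"
    using geometric_band_count_le[OF x \<open>K \<ge> 1\<close>]
    by (intro mult_right_mono) (auto simp: m_def a_def)
  finally show ?thesis by (simp add: mult_ac)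
qed

end
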